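(* Let $A,B \subseteq 2^{\mathbb{N}}$. Then $A$ and $B$ are separable by a monotone Borel set (that is, there is a monotone Borel set $S \subseteq 2^{\mathbb{N}}$ with $A \subseteq S$ and $S \cap B = \emptyset$) if and only if Player I has a winning strategy in the monotone Borel cut-and-choose game $\mathrm{mBCG}_{A,B}$.
   Context: $2^{\mathbb{N}}$ is the Cantor space of infinite binary strings $x = x_0x_1\cdots$ with its usual product topology. Write $x \leq y$ if $x_i \leq y_i$ for every $i \in \mathbb{N}$. A set $S \subseteq 2^{\mathbb{N}}$ is monotone if its characteristic function is monotone, i.e. $x \in S$ and $x \leq y$ imply $y \in S$. The monotone Borel cut-and-choose game $\mathrm{mBCG}_{A,B}$ is played between Player I (Cut) and Player II (Choose) as follows. Start with $A^{(0)} = A$ and $B^{(0)} = B$. In the $n$-th round ($n \in \mathbb{N}$), Player I partitions either $A^{(n)}$ into countably many pieces $A^{(n)}_0, A^{(n)}_1, \dots$, or $B^{(n)}$ into countably many pieces $B^{(n)}_0, B^{(n)}_1, \dots$ (here a partition into countably many pieces means a sequence of pairwise disjoint, possibly empty, sets whose union is the given set). If Player I partitioned $A^{(n)}$, Player II chooses some $j \in \mathbb{N}$ and one sets $A^{(n+1)} = A^{(n)}_j$, $B^{(n+1)} = B^{(n)}$. If Player I partitioned $B^{(n)}$, Player II chooses some $k \in \mathbb{N}$ and one sets $A^{(n+1)} = A^{(n)}$, $B^{(n+1)} = B^{(n)}_k$. Player I wins the run if there exist $i,n \in \mathbb{N}$ such that $x_i = 1$ for all $x \in A^{(n)}$ and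 $y_i = 0$ for all $y \in B^{(n)}$; otherwise Player II wins.
   Formalization: Two degenerate cases in which the equivalence fails are excluded: A empty with the all-ones string in B, and B empty with the all-zeros string in A (there the empty set, resp. the whole space, separates, but Player II wins). *)

theory Defs
  imports "HOL-Analysis.Analysis"
begin

(* Strings are functions nat => bool with True for 1. The library topology on this type is the
   product of discrete topologies, and the library order is the pointwise one. *)
type_synonym cantor = "nat \<Rightarrow> bool"

definition monotone_set :: "cantor set \<Rightarrow> bool" where
  "monotone_set S \<longleftrightarrow> mono (\<lambda>x. x \<in> S)"

definition monotone_Borel_separable :: "cantor set \<Rightarrow> cantor set \<Rightarrow> bool" where
  "monotone_Borel_separable A B \<longleftrightarrow>
     (\<exists>S. monotone_set S \<and> S \<in> sets borel \<and> A \<subseteq> S \<and> S \<inter> B = {})"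

datatype cut = Cut_A "nat \<Rightarrow> cantor set" | Cut_B "nat \<Rightarrow> cantor set"

definition is_partition :: "(nat \<Rightarrow> cantor set) \<Rightarrow> cantor set \<Rightarrow> bool" where
  "is_partition P X \<longleftrightarrow> disjoint_family P \<and> (\<Union>j. P j) = X"

fun legal_cut :: "cut \<Rightarrow> cantor set \<times> cantor set \<Rightarrow> bool" where
  "legal_cut (Cut_A P) (A, B) \<longleftrightarrow> is_partition P A"
| "legal_cut (Cut_B P) (A, B) \<longleftrightarrow> is_partition P B"

fun next_position :: "cut \<Rightarrow> nat \<Rightarrow> cantor set \<times> cantor set \<Rightarrow> cantor set \<times> cantor set" where
  "next_position (Cut_A P) j (A, B) = (P j, B)"
| "next_position (Cut_B P) k (A, B) = (A, P k)"

(* A strategy for Player I maps the list of Player II's choices so far to the next cut; Player I's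
   own earlier moves are determined by the strategy. *)
type_synonym strategy = "nat list \<Rightarrow> cut"

primrec run_position ::
  "strategy \<Rightarrow> (nat \<Rightarrow> nat) \<Rightarrow> cantor set \<Rightarrow> cantor set \<Rightarrow> nat \<Rightarrow> cantor set \<times> cantor set" where
  "run_position \<sigma> c A B 0 = (A, B)"
| "run_position \<sigma> c A B (Suc n) =
     next_position (\<sigma> (map c [0..<n])) (c n) (run_position \<sigma> c A B n)"

(* Both conditions are needed at the same coordinate i, even when one of the two sets is empty. So if
   A = {} and B contains the all-ones string, then {} separates A from B, but Player II wins by
   keeping that string in B; dually for B = {} and the all-zeros string. *)
definition I_wins_run :: "(nat \<Rightarrow> cantor set \<times> cantor set) \<Rightarrow> bool" where
  "I_wins_run p \<longleftrightarrow> (\<exists>i n. (\<forall>x\<in>fst (p n). x i) \<and> (\<forall>y\<in>snd (p n). \<not> y i))"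

definition winning_strategy_I :: "cantor set \<Rightarrow> cantor set \<Rightarrow> strategy \<Rightarrow> bool" where
  "winning_strategy_I A B \<sigma> \<longleftrightarrow>
     (\<forall>c. (\<forall>n. legal_cut (\<sigma> (map c [0..<n])) (run_position \<sigma> c A B n))
        \<and> I_wins_run (run_position \<sigma> c A B))"

end

theory Submission
  imports Defs
begin

text \<open>
  Suppose that a monotone Borel set \<open>S\<close> separates \<open>A\<close> from \<open>B\<close>. Both \<open>S\<close> and its complement are
  analytic, so each of them is the projection of a closed subset of \<open>2\<^sup>\<nat> \<times> \<nat>\<^sup>\<nat>\<close>; choose for every
  point of \<open>S\<close>, and for every point of \<open>- S\<close>, a witness in \<open>\<nat>\<^sup>\<nat>\<close>. Player I alternately cuts the two
  sets, at the \<open>k\<close>-th visit according to the \<open>k\<close>-th bit of the point and the \<open>k\<close>-th entry of its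
  witness. If no position becomes empty, the choices of Player II spell a point \<open>x\<close> with a witness
  and a point \<open>y\<close> with a witness, and closedness puts \<open>x\<close> in \<open>S\<close> and \<open>y\<close> in \<open>- S\<close>. As \<open>S\<close> is
  monotone, \<open>x \<le> y\<close> fails, so some coordinate \<open>i\<close> has \<open>x i\<close> and \<open>\<not> y i\<close>; once the bits at \<open>i\<close>
  have been cut, Player I has won. If one side becomes empty, any point of \<open>S\<close> (respectively \<open>- S\<close>)
  can play the part of \<open>x\<close> (respectively \<open>y\<close>); so \<open>S\<close> has to be neither empty nor everything, and
  the two excluded cases of the theorem are those in which it cannot be chosen that way.
  The witnesses come from \<open>borel_closed_labelling\<close>, the limit points from \<open>labelled_limit\<close>.

  Conversely, suppose that \<open>A\<close> and \<open>B\<close> are not separable. Separating sets for all the pieces of a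
  cut combine, by a countable union or intersection, to a separating set for the pair that was cut.
  Hence Player II can always answer so that the pair stays inseparable, whereas a pair at which
  Player I has won at \<open>i\<close> is separated by \<open>{x. x i}\<close>.
\<close>

section \<open>Closed labellings of Borel sets\<close>

text \<open>
  The condition says that the closure of the graph of \<open>\<phi>\<close> on \<open>S\<close>, in \<open>2\<^sup>\<nat> \<times> \<nat>\<^sup>\<nat>\<close>, projects into
  \<open>S\<close>. It thus presents \<open>S\<close> as an analytic set together with a choice of witnesses.
\<close>

definition closed_labelling :: "cantor set \<Rightarrow> (cantor \<Rightarrow> nat \<Rightarrow> nat) \<Rightarrow> bool" where
  "closed_labelling S \<phi> \<longleftrightarrow>
     (\<forall>x a. (\<forall>n. \<exists>z\<in>S. \<forall>k<n. z k = x k \<and> \<phi> z k = a k) \<longrightarrow> x \<in> S)"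

lemma closed_labellingI:
  assumes "\<And>x a. (\<And>n. \<exists>z\<in>S. \<forall>k<n. z k = x k \<and> \<phi> z k = a k) \<Longrightarrow> x \<in> S"
  shows "closed_labelling S \<phi>"
  using assms unfolding closed_labelling_def by blast

lemma closed_labellingD:
  assumes "closed_labelling S \<phi>" "\<And>n. \<exists>z\<in>S. \<forall>k<n. z k = x k \<and> \<phi> z k = a k"
  shows "x \<in> S"
  using assms unfolding closed_labelling_def by blast

lemma closed_labelling_coordinate: "closed_labelling {x. x i \<in> C} \<phi>"
proof (rule closed_labellingI)
  fix x a
  assume "\<And>n. \<exists>z\<in>{x. x i \<in> C}. \<forall>k<n. z k = x k \<and> \<phi> z k = a k"
  from this[of "Suc i"] obtain z where "z i \<in> C" "z i = x i" by auto
  then show "x \<in> {x. x i \<in> C}" by simp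
qed

text \<open>A label for a point of a union first names a member of the family that contains the point.\<close>

lemma closed_labelling_Union:
  fixes T :: "nat \<Rightarrow> cantor set"
  assumes "\<And>k. \<exists>\<phi>. closed_labelling (T k) \<phi>"
  shows "\<exists>\<psi>. closed_labelling (\<Union>k. T k) \<psi>"
proof
  define \<phi> where "\<phi> k = (SOME \<phi>. closed_labelling (T k) \<phi>)" for k
  have \<phi>: "closed_labelling (T k) (\<phi> k)" for k
    unfolding \<phi>_def using assms by (rule someI_ex)
  let ?K = "\<lambda>z. LEAST k. z \<in> T k"
  let ?\<psi> = "\<lambda>z m. case m of 0 \<Rightarrow> ?K z | Suc l \<Rightarrow> \<phi> (?K z) z l"
  show "closed_labelling (\<Union>k. T k) ?\<psi>"
  proof (rule closed_labellingI)
    fix x a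
    assume *: "\<And>n. \<exists>z\<in>(\<Union>k. T k). \<forall>k<n. z k = x k \<and> ?\<psi> z k = a k"
    have "x \<in> T (a 0)"
    proof (rule closed_labellingD[OF \<phi>])
      fix n
      obtain z where z: "z \<in> (\<Union>k. T k)" "\<forall>k<Suc n. z k = x k \<and> ?\<psi> z k = a k"
        using *[of "Suc n"] by blast
      have K: "?K z = a 0" using z(2)[rule_format, of 0] by simp
      have "z \<in> T (?K z)" using z(1) by (auto intro: LeastI)
      moreover have "z l = x l \<and> \<phi> (a 0) z l = a (Suc l)" if "l < n" for l
        using z(2)[rule_format, of l] z(2)[rule_format, of "Suc l"] that K by simp
      ultimately show "\<exists>z\<in>T (a 0). \<forall>k<n. z k = x k \<and> \<phi> (a 0) z k = a (Suc k)"
        using K by auto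
    qed
    then show "x \<in> (\<Union>k. T k)" by blast
  qed
qed

text \<open>A label for a point of an intersection interleaves its labels for all the members.\<close>

lemma closed_labelling_Inter:
  fixes T :: "nat \<Rightarrow> cantor set"
  assumes "\<And>k. \<exists>\<phi>. closed_labelling (T k) \<phi>"
  shows "\<exists>\<psi>. closed_labelling (\<Inter>k. T k) \<psi>"
proof
  define \<phi> where "\<phi> k = (SOME \<phi>. closed_labelling (T k) \<phi>)" for k
  have \<phi>: "closed_labelling (T k) (\<phi> k)" for k
    unfolding \<phi>_def using assms by (rule someI_ex)
  let ?\<psi> = "\<lambda>z m. \<phi> (fst (prod_decode m)) z (snd (prod_decode m))"
  show "closed_labelling (\<Inter>k. T k) ?\<psi>"
  proof (rule closed_labellingI)
    fix x a
    assume *: "\<And>n. \<exists>z\<in>(\<Inter>k. T k). \<forall>k<n. z k = x k \<and> ?\<psi> z k = a k"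
    have "x \<in> T k" for k
    proof (rule closed_labellingD[OF \<phi>])
      fix n
      have "finite ({..<n} \<union> (\<lambda>l. prod_encode (k, l)) ` {..<n})" by simp
      then obtain N where N: "{..<n} \<union> (\<lambda>l. prod_encode (k, l)) ` {..<n} \<subseteq> {..<N}"
        using finite_nat_bounded by blast
      obtain z where z: "z \<in> (\<Inter>k. T k)" "\<forall>k<N. z k = x k \<and> ?\<psi> z k = a k"
        using *[of N] by blast
      have "z l = x l \<and> \<phi> k z l = a (prod_encode (k, l))" if "l < n" for l
      proof -
        have "l < N" "prod_encode (k, l) < N" using N that by auto
        then show ?thesis using z(2)[rule_format, of l] z(2)[rule_format, of "prod_encode (k, l)"]
          by simp
      qed
      then show "\<exists>z\<in>T k. \<forall>l<n. z l = x l \<and> \<phi> k z l = a (prod_encode (k, l))"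
        using z(1) by blast
    qed
    then show "x \<in> (\<Inter>k. T k)" by blast
  qed
qed

text \<open>
  Second countability of the factors makes the Borel sets of the product the product
  \<open>\<sigma>\<close>-algebra, so that they are generated by conditions on single coordinates.
\<close>

instance bool :: second_countable_topology
proof
  have "open S \<longleftrightarrow> generate_topology UNIV S" for S :: "bool set"
    by (simp add: open_discrete generate_topology.Basis)
  then show "\<exists>\<B> :: bool set set. countable \<B> \<and> open = generate_topology \<B>"
    by (intro exI[of _ UNIV]) (auto simp: fun_eq_iff intro: countable_finite)
qed

lemma sets_borel_cantor:
  "sets (borel :: cantor measure) = sigma_sets UNIV {{x. x i \<in> C} | i C. True}"
proof -
  have "sets (borel :: cantor measure) = sets (Pi\<^sub>M UNIV (\<lambda>_. borel :: bool measure))"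
    by (rule sets_PiM_equal_borel[symmetric])
  moreover have "C \<in> sets borel" for C :: "bool set"
    by (simp add: countable_finite sets.countable)
  ultimately show ?thesis
    by (simp add: sets_PiM_single)
qed

text \<open>
  Complements of labelled sets need not have labellings, so the induction carries a set together
  with its complement.
\<close>

lemma borel_closed_labelling:
  fixes S :: "cantor set"
  assumes "S \<in> sets borel"
  shows "(\<exists>\<phi>. closed_labelling S \<phi>) \<and> (\<exists>\<phi>. closed_labelling (- S) \<phi>)"
  using assms unfolding sets_borel_cantor
proof (induction rule: sigma_sets.induct)
  case (Basic S)
  then obtain i C where S: "S = {x. x i \<in> C}" by blast
  moreover have "- S = {x. x i \<in> - C}" using S by auto
  ultimately show ?case by (simp only: closed_labelling_coordinate) simp
next
  case Empty
  show ?case by (simp add: closed_labelling_def)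
next
  case (Compl S)
  then show ?case by (simp add: Compl_eq_Diff_UNIV[symmetric])
next
  case (Union T)
  then show ?case
    using closed_labelling_Union[of T] closed_labelling_Inter[of "\<lambda>k. - T k"]
    by (simp add: Compl_UN)
qed

section \<open>Playing from a separating set\<close>

text \<open>The answer that keeps \<open>z\<close> when Player I cuts by the \<open>k\<close>-th bit and the \<open>k\<close>-th label entry.\<close>

definition cut_code :: "(cantor \<Rightarrow> nat \<Rightarrow> nat) \<Rightarrow> cantor \<Rightarrow> nat \<Rightarrow> nat" where
  "cut_code \<phi> z k = to_nat (z k, \<phi> z k)"

text \<open>
  The answers \<open>c\<close> spell a point together with a label. If every finite stage of \<open>c\<close> is matched by
  some point of \<open>A\<close>, the point that is spelled lies in \<open>S\<close>, because the labelling is closed.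
  Otherwise nothing in \<open>A\<close> survives some finite stage, and any point of \<open>S\<close> serves as \<open>x\<close>.
\<close>

lemma labelled_limit:
  assumes "closed_labelling S \<phi>" "S \<noteq> {}" "A \<subseteq> S"
  shows "\<exists>x\<in>S. \<forall>i. \<exists>n. \<forall>z\<in>A. (\<forall>k<n. cut_code \<phi> z k = c k) \<longrightarrow> z i = x i"
proof (cases "\<forall>n. \<exists>z\<in>A. \<forall>k<n. cut_code \<phi> z k = c k")
  case True
  define x where "x k = fst (from_nat (c k) :: bool \<times> nat)" for k
  define a where "a k = snd (from_nat (c k) :: bool \<times> nat)" for k
  have decode: "z k = x k \<and> \<phi> z k = a k" if "cut_code \<phi> z k = c k" for z k
    using that[symmetric] by (simp add: x_def a_def cut_code_def)
  have "x \<in> S"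
    using assms(1)
  proof (rule closed_labellingD[where a = a])
    fix n
    obtain z where "z \<in> A" "\<forall>k<n. cut_code \<phi> z k = c k" using True by blast
    then show "\<exists>z\<in>S. \<forall>k<n. z k = x k \<and> \<phi> z k = a k"
      using decode assms(3) by (intro bexI[of _ z]) auto
  qed
  moreover have "\<forall>z\<in>A. (\<forall>k<Suc i. cut_code \<phi> z k = c k) \<longrightarrow> z i = x i" for i
    using decode by blast
  ultimately show ?thesis by blast
next
  case False
  then show ?thesis using assms(2) by blast
qed

text \<open>
  Even rounds cut \<open>A\<close> and odd rounds cut \<open>B\<close>; the pair reached after the answers \<open>cs\<close> is computed
  directly from \<open>cs\<close>.
\<close>

definition label_position ::
  "(cantor \<Rightarrow> nat \<Rightarrow> nat) \<Rightarrow> (cantor \<Rightarrow> nat \<Rightarrow> nat) \<Rightarrow> cantor set \<Rightarrow> cantor set \<Rightarrow> nat list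
     \<Rightarrow> cantor set \<times> cantor set" where
  "label_position \<phi> \<psi> A B cs =
     ({z\<in>A. \<forall>k. 2 * k < length cs \<longrightarrow> cut_code \<phi> z k = cs ! (2 * k)},
      {z\<in>B. \<forall>k. 2 * k + 1 < length cs \<longrightarrow> cut_code \<psi> z k = cs ! (2 * k + 1)})"

definition label_strategy ::
  "(cantor \<Rightarrow> nat \<Rightarrow> nat) \<Rightarrow> (cantor \<Rightarrow> nat \<Rightarrow> nat) \<Rightarrow> cantor set \<Rightarrow> cantor set \<Rightarrow> strategy" where
  "label_strategy \<phi> \<psi> A B cs =
     (let (A', B') = label_position \<phi> \<psi> A B cs; k = length cs div 2 in
        if even (length cs) then Cut_A (\<lambda>j. {z\<in>A'. cut_code \<phi> z k = j})
        else Cut_B (\<lambda>j. {z\<in>B'. cut_code \<psi> z k = j}))"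

lemma legal_label_strategy:
  "legal_cut (label_strategy \<phi> \<psi> A B cs) (label_position \<phi> \<psi> A B cs)"
  by (auto simp: label_strategy_def label_position_def is_partition_def disjoint_family_on_def Let_def)

lemma next_label_position:
  "next_position (label_strategy \<phi> \<psi> A B cs) j (label_position \<phi> \<psi> A B cs)
     = label_position \<phi> \<psi> A B (cs @ [j])"
proof (cases "even (length cs)")
  case True
  then obtain m where m: "length cs = 2 * m" by (elim evenE)
  have "(2 * k < Suc (2 * m)) = (2 * k < 2 * m \<or> k = m)"
    "(2 * k + 1 < Suc (2 * m)) = (2 * k + 1 < 2 * m)" for k by presburger+
  then show ?thesis using m
    by (auto simp: label_strategy_def label_position_def nth_append)
next
  case False
  then obtain m where m: "length cs = 2 * m + 1" by (elim oddE)
  have "(2 * k < Suc (2 * m + 1)) = (2 * k < 2 * m + 1)"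
    "(2 * k + 1 < Suc (2 * m + 1)) = (2 * k + 1 < 2 * m + 1 \<or> k = m)" for k by presburger+
  then show ?thesis using m
    by (auto simp: label_strategy_def label_position_def nth_append)
qed

lemma run_label_strategy:
  "run_position (label_strategy \<phi> \<psi> A B) c A B n = label_position \<phi> \<psi> A B (map c [0..<n])"
proof (induction n)
  case 0
  then show ?case by (simp add: label_position_def)
next
  case (Suc n)
  then show ?case by (simp add: next_label_position)
qed

lemma label_strategy_wins:
  assumes "monotone_set S"
    and \<phi>: "closed_labelling S \<phi>" "S \<noteq> {}" "A \<subseteq> S"
    and \<psi>: "closed_labelling (- S) \<psi>" "- S \<noteq> {}" "B \<subseteq> - S"
  shows "winning_strategy_I A B (label_strategy \<phi> \<psi> A B)"
  unfolding winning_strategy_I_def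
proof (intro allI conjI)
  fix c n
  show "legal_cut (label_strategy \<phi> \<psi> A B (map c [0..<n]))
    (run_position (label_strategy \<phi> \<psi> A B) c A B n)"
    unfolding run_label_strategy by (rule legal_label_strategy)
next
  fix c
  obtain x where x: "x \<in> S"
    "\<And>i. \<exists>n. \<forall>z\<in>A. (\<forall>k<n. cut_code \<phi> z k = c (2 * k)) \<longrightarrow> z i = x i"
    using labelled_limit[OF \<phi>, of "\<lambda>k. c (2 * k)"] by blast
  obtain y where y: "y \<in> - S"
    "\<And>i. \<exists>n. \<forall>z\<in>B. (\<forall>k<n. cut_code \<psi> z k = c (2 * k + 1)) \<longrightarrow> z i = y i"
    using labelled_limit[OF \<psi>, of "\<lambda>k. c (2 * k + 1)"] by blast
  have "\<not> x \<le> y"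
    using assms(1) x(1) y(1) unfolding monotone_set_def mono_def by (auto simp: le_bool_def)
  then obtain i where i: "x i" "\<not> y i" by (auto simp: le_fun_def)
  obtain n where n: "\<forall>z\<in>A. (\<forall>k<n. cut_code \<phi> z k = c (2 * k)) \<longrightarrow> z i = x i"
    using x(2) by blast
  obtain m where m: "\<forall>z\<in>B. (\<forall>k<m. cut_code \<psi> z k = c (2 * k + 1)) \<longrightarrow> z i = y i"
    using y(2) by blast
  \<comment> \<open>After \<open>2 * max n m\<close> rounds each side has been cut \<open>max n m\<close> times.\<close>
  let ?p = "label_position \<phi> \<psi> A B (map c [0..<2 * max n m])"
  have "\<forall>z\<in>fst ?p. z i" using n i(1) by (auto simp: label_position_def)
  moreover have "\<forall>z\<in>snd ?p. \<not> z i" using m i(2) by (auto simp: label_position_def)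
  ultimately show "I_wins_run (run_position (label_strategy \<phi> \<psi> A B) c A B)"
    unfolding I_wins_run_def run_label_strategy by blast
qed

lemma borel_coordinate: "{x :: cantor. x i} \<in> sets borel"
proof -
  have "{x :: cantor. x i} = {x. x i \<in> {True}}" by simp
  then show ?thesis unfolding sets_borel_cantor by (blast intro: sigma_sets.Basic)
qed

lemma monotone_coordinate: "monotone_set {x. x i}"
  by (auto simp: monotone_set_def mono_def le_fun_def)

text \<open>
  A separating set that is empty is replaced by the singleton of the all-ones string, which is not in
  \<open>B\<close> because \<open>A\<close> is then empty; dually, one that is everything is replaced by the complement of the
  singleton of the all-zeros string.
\<close>

lemma proper_separating_set:
  assumes "\<not> (A = {} \<and> (\<lambda>_. True) \<in> B)" "\<not> (B = {} \<and> (\<lambda>_. False) \<in> A)"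
    and "monotone_Borel_separable A B"
  obtains S where "monotone_set S" "S \<in> sets borel" "A \<subseteq> S" "B \<subseteq> - S" "S \<noteq> {}" "- S \<noteq> {}"
proof -
  obtain S where S: "monotone_set S" "S \<in> sets borel" "A \<subseteq> S" "S \<inter> B = {}"
    using assms(3) unfolding monotone_Borel_separable_def by blast
  consider "S = {}" | "S = UNIV" | "S \<noteq> {}" "- S \<noteq> {}" by auto
  then show ?thesis
  proof cases
    case 1
    let ?S = "\<Inter>i. {x :: cantor. x i}"
    have eq: "?S = {\<lambda>_. True}" by auto
    show ?thesis
    proof
      show "monotone_set ?S" by (auto simp: monotone_set_def mono_def le_fun_def)
      show "?S \<in> sets borel" using borel_coordinate by (intro sets.countable_INT) auto
      show "A \<subseteq> ?S" "B \<subseteq> - ?S" using 1 S(3) assms(1) unfolding eq by auto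
      show "?S \<noteq> {}" unfolding eq by simp
      have "(\<lambda>_. False) \<in> - ?S" by simp
      then show "- ?S \<noteq> {}" by blast
    qed
  next
    case 2
    let ?S = "\<Union>i. {x :: cantor. x i}"
    have eq: "?S = - {\<lambda>_. False}" by auto
    show ?thesis
    proof
      show "monotone_set ?S" by (auto simp: monotone_set_def mono_def le_fun_def)
      show "?S \<in> sets borel" using borel_coordinate by (intro sets.countable_UN) auto
      show "A \<subseteq> ?S" "B \<subseteq> - ?S" using 2 S(4) assms(2) unfolding eq by auto
      have "(\<lambda>_. True) \<in> ?S" by simp
      then show "?S \<noteq> {}" by blast
      show "- ?S \<noteq> {}" unfolding eq by simp
    qed
  next
    case 3
    then show ?thesis using S that by blast
  qed
qed

section \<open>Separating from a winning strategy\<close>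

lemma separable_before_cut:
  assumes "legal_cut C (A, B)"
    and "\<And>j. case_prod monotone_Borel_separable (next_position C j (A, B))"
  shows "monotone_Borel_separable A B"
proof (cases C)
  case (Cut_A P)
  then have "\<forall>j. monotone_Borel_separable (P j) B" using assms(2) by simp
  then obtain S where S: "\<And>j. monotone_set (S j)" "\<And>j. S j \<in> sets borel"
    "\<And>j. P j \<subseteq> S j" "\<And>j. S j \<inter> B = {}"
    unfolding monotone_Borel_separable_def by metis
  have "monotone_set (\<Union>j. S j)"
    using S(1) unfolding monotone_set_def mono_def le_bool_def by blast
  moreover have "(\<Union>j. S j) \<in> sets borel" using S(2) by auto
  moreover have "A \<subseteq> (\<Union>j. S j)" using assms(1) S(3) Cut_A by (auto simp: is_partition_def)
  moreover have "(\<Union>j. S j) \<inter> B = {}" using S(4) by auto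
  ultimately show ?thesis unfolding monotone_Borel_separable_def by blast
next
  case (Cut_B P)
  then have "\<forall>j. monotone_Borel_separable A (P j)" using assms(2) by simp
  then obtain S where S: "\<And>j. monotone_set (S j)" "\<And>j. S j \<in> sets borel"
    "\<And>j. A \<subseteq> S j" "\<And>j. S j \<inter> P j = {}"
    unfolding monotone_Borel_separable_def by metis
  have "monotone_set (\<Inter>j. S j)"
    using S(1) unfolding monotone_set_def mono_def le_bool_def by blast
  moreover have "(\<Inter>j. S j) \<in> sets borel" using S(2) by auto
  moreover have "A \<subseteq> (\<Inter>j. S j)" using S(3) by blast
  moreover have "(\<Inter>j. S j) \<inter> B = {}"
    using assms(1) S(4) Cut_B by (fastforce simp: is_partition_def)
  ultimately show ?thesis unfolding monotone_Borel_separable_def by blast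
qed

lemma run_position_cong:
  assumes "\<And>k. k < n \<Longrightarrow> c k = d k"
  shows "run_position \<sigma> c A B n = run_position \<sigma> d A B n"
  using assms
proof (induction n)
  case (Suc n)
  then have "map c [0..<n] = map d [0..<n]" by simp
  then show ?case using Suc by (simp del: map_eq_conv)
qed simp

text \<open>
  The run is built from finite lists of answers, each extending the one before; an answer that keeps
  the pair inseparable exists by \<open>separable_before_cut\<close>.
\<close>

lemma inseparable_run:
  assumes legal: "\<And>c n. legal_cut (\<sigma> (map c [0..<n])) (run_position \<sigma> c A B n)"
    and "\<not> monotone_Borel_separable A B"
  shows "\<exists>c. \<forall>n. \<not> case_prod monotone_Borel_separable (run_position \<sigma> c A B n)"
proof -
  let ?pos = "\<lambda>cs. run_position \<sigma> (\<lambda>k. cs ! k) A B (length cs)"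
  define good where "good cs \<longleftrightarrow> \<not> case_prod monotone_Borel_separable (?pos cs)" for cs
  have step: "\<exists>j. good (cs @ [j])" if "good cs" for cs
  proof (rule ccontr)
    assume sep: "\<nexists>j. good (cs @ [j])"
    have map_cs: "map (\<lambda>k. (cs @ [j]) ! k) [0..<length cs] = cs" for j
      by (rule nth_equalityI) (auto simp: nth_append)
    have "?pos (cs @ [j]) = next_position (\<sigma> cs) j (?pos cs)" for j
      using map_cs[of j] run_position_cong[of "length cs" "\<lambda>k. (cs @ [j]) ! k" "\<lambda>k. cs ! k" \<sigma> A B]
      by (simp add: nth_append)
    with sep have "case_prod monotone_Borel_separable (next_position (\<sigma> cs) j (?pos cs))" for j
      by (simp add: good_def)
    moreover have "legal_cut (\<sigma> cs) (?pos cs)"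
      using legal[of "\<lambda>k. cs ! k" "length cs"] by (simp add: map_nth)
    ultimately show False
      using that separable_before_cut[of "\<sigma> cs" "fst (?pos cs)" "snd (?pos cs)"]
      by (simp add: case_prod_unfold good_def)
  qed
  have "\<exists>f. \<forall>n. (length (f n) = n \<and> good (f n)) \<and> (\<exists>j. f (Suc n) = f n @ [j])"
  proof (rule dependent_nat_choice)
    show "\<exists>cs. length cs = 0 \<and> good cs" using assms(2) by (simp add: good_def)
  next
    fix cs n
    assume "length cs = n \<and> good cs"
    then show "\<exists>ds. (length ds = Suc n \<and> good ds) \<and> (\<exists>j. ds = cs @ [j])"
      using step[of cs] by (metis length_append_singleton)
  qed
  then obtain f where f: "\<And>n. length (f n) = n" "\<And>n. good (f n)"
    and "\<And>n. \<exists>j. f (Suc n) = f n @ [j]" by blast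
  then obtain c where c: "\<And>n. f (Suc n) = f n @ [c n]" by metis
  have nth: "f n ! k = c k" if "k < n" for n k
    using that by (induction n) (auto simp: c f(1) nth_append less_Suc_eq)
  have "run_position \<sigma> c A B n = ?pos (f n)" for n
    unfolding f(1) using nth by (intro run_position_cong) simp
  then show ?thesis using f(2) unfolding good_def by metis
qed

lemma winning_strategy_separates:
  assumes "winning_strategy_I A B \<sigma>"
  shows "monotone_Borel_separable A B"
proof (rule ccontr)
  assume "\<not> monotone_Borel_separable A B"
  then obtain c where
    c: "\<And>n. \<not> case_prod monotone_Borel_separable (run_position \<sigma> c A B n)"
    using inseparable_run[of \<sigma> A B] assms unfolding winning_strategy_I_def by blast
  obtain i n where "\<forall>x\<in>fst (run_position \<sigma> c A B n). x i"
    "\<forall>y\<in>snd (run_position \<sigma> c A B n). \<not> y i"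
    using assms unfolding winning_strategy_I_def I_wins_run_def by blast
  then have "monotone_Borel_separable (fst (run_position \<sigma> c A B n)) (snd (run_position \<sigma> c A B n))"
    unfolding monotone_Borel_separable_def
    using monotone_coordinate[of i] borel_coordinate[of i] by blast
  then show False using c[of n] by (simp add: case_prod_unfold)
qed

theorem theorem7p6:
  fixes A B :: "cantor set"
  assumes "\<not> (A = {} \<and> (\<lambda>_. True) \<in> B)"
    and "\<not> (B = {} \<and> (\<lambda>_. False) \<in> A)"
  shows "monotone_Borel_separable A B \<longleftrightarrow> (\<exists>\<sigma>. winning_strategy_I A B \<sigma>)"
proof
  assume "monotone_Borel_separable A B"
  with assms obtain S
    where S: "monotone_set S" "S \<in> sets borel" "A \<subseteq> S" "B \<subseteq> - S" "S \<noteq> {}" "- S \<noteq> {}"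
    by (rule proper_separating_set)
  obtain \<phi> \<psi> where "closed_labelling S \<phi>" "closed_labelling (- S) \<psi>"
    using borel_closed_labelling[OF S(2)] by blast
  then show "\<exists>\<sigma>. winning_strategy_I A B \<sigma>"
    using label_strategy_wins S by blast
next
  assume "\<exists>\<sigma>. winning_strategy_I A B \<sigma>"
  then show "monotone_Borel_separable A B"
    using winning_strategy_separates by blast
qed

end
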